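(* Let $h=0$. If $$\xi'(1)>\xi''(0)(1+z)$$ and the function $s\mapsto\dfrac{s}{\xi'(s)}$ is convex on $(0,1)$, then $\zeta(s)<0$ for all $s\in(0,1)$.
   Context: Fix reals $c_p\ge 0$, $p\in 2\mathbb{N}=\{2,4,6,\dots\}$, with $\sum_{p}c_p=1$ and $\sum_p 2^pc_p<\infty$; put $\xi(s)=\sum_{p\in2\mathbb{N}}c_ps^p$ (the mixture of a spherical mixed even $p$-spin model; $h\ge0$ is its external field strength, which does not enter the definitions below). Let $z\ge0$ be the unique solution of $$\frac1{\xi'(1)}=\frac{1+z}{z^2}\log(1+z)-\frac1z,$$ where the right-hand side is strictly decreasing in $z$, from $1/2$ (its limit at $z=0$) to $0$ as $z\to\infty$; since $\xi'(1)\ge2$ the solution exists, and $z=0$ iff $\xi(s)=s^2$. If $c_p\ne0$ for at least one $p\ge4$, then $z>0$ and one defines, for $s\in[0,1]$, $$\zeta(s)=\xi(s)+\xi'(s)(1-s)+\frac{\xi'(s)}{z}-\frac{(1+z)\xi'(1)}{z^2}\log\Bigl(1+\frac{z\xi'(s)}{\xi'(1)}\Bigr).$$ (If $\xi(s)=s^2$, then $z=0$, $\xi'(1)=\xi''(0)=2$, and the first hypothesis of the claim fails; hence $\zeta$ is defined whenever the hypotheses hold.) *)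

theory Defs
  imports "HOL-Analysis.Analysis"
begin

definition pspin_indices :: "nat set" where
  "pspin_indices = {p. even p \<and> 2 \<le> p}"

text \<open>Only the values of the coefficient function on the even integers \<open>p \<ge> 2\<close> matter.\<close>
definition even_mixture :: "(nat \<Rightarrow> real) \<Rightarrow> bool" where
  "even_mixture c \<longleftrightarrow>
     (\<forall>p\<in>pspin_indices. 0 \<le> c p) \<and>
     (c has_sum 1) pspin_indices \<and>
     (\<lambda>p. 2 ^ p * c p) summable_on pspin_indices"

text \<open>For a mixture the series converges on \<open>[-2, 2]\<close>, so the derivatives at 0 and on
  \<open>(0, 1]\<close> used below are genuine two-sided derivatives.\<close>
definition xi :: "(nat \<Rightarrow> real) \<Rightarrow> real \<Rightarrow> real" where
  "xi c s = (\<Sum>\<^sub>\<infinity>p\<in>pspin_indices. c p * s ^ p)"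

text \<open>The value at 0 is the limit from the right.\<close>
definition z_rhs :: "real \<Rightarrow> real" where
  "z_rhs z = (if z = 0 then 1 / 2 else (1 + z) / z\<^sup>2 * ln (1 + z) - 1 / z)"

text \<open>The equation characterises \<open>z\<close> uniquely, since \<open>z_rhs\<close> is a strictly decreasing
  bijection from \<open>[0, \<infinity>)\<close> onto \<open>(0, 1/2]\<close> and \<open>\<xi>'(1) \<ge> 2\<close>.\<close>
definition is_z_param :: "(nat \<Rightarrow> real) \<Rightarrow> real \<Rightarrow> bool" where
  "is_z_param c z \<longleftrightarrow> 0 \<le> z \<and> 1 / deriv (xi c) 1 = z_rhs z"

text \<open>Meaningful only for \<open>z > 0\<close>, i.e. unless \<open>\<xi>(s) = s\<^sup>2\<close>.\<close>
definition zeta_fun :: "(nat \<Rightarrow> real) \<Rightarrow> real \<Rightarrow> real \<Rightarrow> real" where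
  "zeta_fun c z s =
     xi c s + deriv (xi c) s * (1 - s) + deriv (xi c) s / z
     - (1 + z) * deriv (xi c) 1 / z\<^sup>2 * ln (1 + z * deriv (xi c) s / deriv (xi c) 1)"

end

theory Submission
  imports Defs
begin

text \<open>
  Write \<open>a = \<xi>'(1)\<close>. Differentiating \<open>\<zeta>\<close>, the two terms with \<open>\<xi>'\<close> cancel and

    \<open>\<zeta>'(s) = (\<xi>''(s) \<xi>'(s) / (a + z \<xi>'(s))) \<phi>(s)\<close>,  where  \<open>\<phi>(s) = 1 + z - z s - a (s / \<xi>'(s))\<close>.

  The first factor is positive on \<open>(0,1)\<close>, so \<open>\<phi>\<close> decides the sign of \<open>\<zeta>'\<close>. Convexity of
  \<open>s / \<xi>'(s)\<close> makes \<open>\<phi>\<close> concave, and \<open>\<phi>(1) = 0\<close>. The inequality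
  \<open>a > \<xi>''(0) (1 + z)\<close> says exactly that \<open>\<xi>'(s) \<phi>(s)\<close>, which vanishes at \<open>0\<close>, has negative
  slope there; hence \<open>\<phi> < 0\<close> near \<open>0\<close>.

  Moreover \<open>\<zeta>(0) = 0\<close>, and the equation that defines \<open>z\<close> is \<open>\<zeta>(1) = 0\<close>. So \<open>\<zeta>\<close> starts by
  decreasing from \<open>0\<close>. Were it nonnegative again at some \<open>t < 1\<close>, then \<open>\<phi>\<close> would be positive
  at some \<open>u < t\<close>; a concave function that is positive at \<open>u\<close> and vanishes at \<open>1\<close> is positive in
  between, so \<open>\<zeta>\<close> would increase strictly from \<open>\<zeta>(t) \<ge> 0\<close> to \<open>\<zeta>(1) = 0\<close>, which is absurd. This
  argument is lemma \<open>neg_between_zeros_if_concave_sign\<close>; everything else is the calculus of the power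
  series \<open>\<xi>\<close> and the exclusion of \<open>z = 0\<close>, where the formula for \<open>\<zeta>\<close> has no meaning.
\<close>

section \<open>A sign argument for functions with two zeros\<close>

text \<open>A nonpositive value at \<open>w\<close> would force, by concavity, a linear descent from \<open>w\<close> on with
  a fixed slope, and continuity would carry it to \<open>1\<close>.\<close>

lemma concave_pos_up_to_zero:
  fixes \<phi> :: "real \<Rightarrow> real"
  assumes conc: "concave_on {0<..<1} \<phi>" and cont: "continuous_on {0<..1} \<phi>"
    and zero: "\<phi> 1 = 0"
    and u: "0 < u" "0 < \<phi> u" and w: "u < w" "w < 1"
  shows "0 < \<phi> w"
proof (rule ccontr)
  assume "\<not> 0 < \<phi> w"
  then have nonpos: "\<phi> w \<le> 0" by simp
  have descent: "\<phi> y \<le> - (\<phi> u / (w - u) * (y - w))" if y: "w < y" "y < 1" for y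
  proof -
    define t where "t = (w - u) / (y - u)"
    have t: "0 < t" "t < 1" using y w by (auto simp: t_def field_simps)
    have comb: "(1 - t) * u + t * y = w"
    proof -
      have "t * (y - u) = w - u" using y w by (simp add: t_def)
      then show ?thesis by (simp add: algebra_simps)
    qed
    have "1 - t = (y - w) / (y - u)" using y w by (simp add: t_def field_simps)
    then have ratio: "(1 - t) / t = (y - w) / (w - u)" using y w by (simp add: t_def)
    have "(1 - t) * \<phi> u + t * \<phi> y \<le> \<phi> ((1 - t) *\<^sub>R u + t *\<^sub>R y)"
      using conc t u w y by (intro concave_onD) auto
    then have "(1 - t) * \<phi> u + t * \<phi> y \<le> 0" using comb nonpos by simp
    then have "t * \<phi> y \<le> - ((1 - t) * \<phi> u)" by simp
    then have "\<phi> y \<le> - ((1 - t) * \<phi> u) / t" using t by (simp add: field_simps)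
    also have "\<dots> = - (\<phi> u * ((1 - t) / t))" by simp
    finally show ?thesis by (simp add: ratio)
  qed
  have "(\<phi> \<longlongrightarrow> \<phi> 1) (at 1 within {0<..1})"
    using cont by (simp add: continuous_on_def)
  then have lim: "(\<phi> \<longlongrightarrow> \<phi> 1) (at 1 within {w<..<1})"
    by (rule tendsto_within_subset) (use u w in auto)
  have limb: "((\<lambda>y. - (\<phi> u / (w - u) * (y - w))) \<longlongrightarrow> - (\<phi> u / (w - u) * (1 - w)))
      (at 1 within {w<..<1})"
    by (intro tendsto_intros)
  have "at (1::real) within {w<..<1} \<noteq> bot"
    using w by (simp add: at_within_eq_bot_iff)
  then have "\<phi> 1 \<le> - (\<phi> u / (w - u) * (1 - w))"
  proof (rule tendsto_le[OF _ limb lim])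
    show "\<forall>\<^sub>F y in at 1 within {w<..<1}. \<phi> y \<le> - (\<phi> u / (w - u) * (y - w))"
      unfolding eventually_at_filter by (intro always_eventually) (use descent in auto)
  qed
  moreover have "0 < \<phi> u / (w - u) * (1 - w)" using u w by simp
  ultimately show False using zero by simp
qed

text \<open>Starting the mean value theorem at a point where \<open>f\<close> is already negative, rather than
  at \<open>0\<close>, yields a strictly positive value of \<open>\<phi>\<close>. This strictness excludes that \<open>f\<close> is
  constantly \<open>0\<close> near \<open>1\<close>.\<close>

lemma neg_between_zeros_if_concave_sign:
  fixes f w \<phi> :: "real \<Rightarrow> real"
  assumes contf: "continuous_on {0..1} f" and f0: "f 0 = 0" and f1: "f 1 = 0"
    and deriv: "\<And>s. 0 < s \<Longrightarrow> s < 1 \<Longrightarrow> (f has_real_derivative w s * \<phi> s) (at s)"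
    and weight: "\<And>s. 0 < s \<Longrightarrow> s < 1 \<Longrightarrow> 0 < w s"
    and conc: "concave_on {0<..<1} \<phi>" and cont: "continuous_on {0<..1} \<phi>"
    and zero: "\<phi> 1 = 0"
    and neg: "eventually (\<lambda>s. \<phi> s < 0) (at_right 0)"
    and t: "0 < t" "t < 1"
  shows "f t < 0"
proof (rule ccontr)
  assume "\<not> f t < 0"
  then have ft: "0 \<le> f t" by simp
  obtain \<delta> where \<delta>: "0 < \<delta>" "\<And>s. 0 < s \<Longrightarrow> s < \<delta> \<Longrightarrow> \<phi> s < 0"
    using neg by (auto simp: eventually_at_right_field)
  define v where "v = min \<delta> t / 2"
  have v: "0 < v" "v < \<delta>" "v < t" using \<delta> t by (auto simp: v_def min_def)
  have mean_value: "\<exists>x. p < x \<and> x < q \<and> f q - f p = (q - p) * (w x * \<phi> x)"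
    if pq: "0 \<le> p" "p < q" "q \<le> 1" for p q
  proof -
    have "continuous_on {p..q} f" using contf by (rule continuous_on_subset) (use pq in auto)
    moreover have "(f has_derivative (*) (w x * \<phi> x)) (at x)" if "p < x" "x < q" for x
      using deriv[of x] that pq by (simp add: has_field_derivative_def)
    ultimately obtain x where "p < x" "x < q" "f q - f p = (w x * \<phi> x) * (q - p)"
      using mvt[of p q f "\<lambda>x. (*) (w x * \<phi> x)"] pq by blast
    then show ?thesis by (auto simp: mult.commute)
  qed
  obtain x where x: "0 < x" "x < v" "f v - f 0 = (v - 0) * (w x * \<phi> x)"
    using mean_value[of 0 v] v t by auto
  have "\<phi> x < 0" "0 < w x" using \<delta>(2)[of x] weight[of x] x v t by auto
  then have fv: "f v < 0" using x v f0 by (simp add: mult_pos_neg)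
  obtain u where u: "v < u" "u < t" "f t - f v = (t - v) * (w u * \<phi> u)"
    using mean_value[of v t] v t by auto
  have "0 < (t - v) * (w u * \<phi> u)" using fv ft u by linarith
  then have \<phi>u: "0 < \<phi> u"
    using weight[of u] u v t by (simp add: zero_less_mult_iff)
  obtain y where y: "t < y" "y < 1" "f 1 - f t = (1 - t) * (w y * \<phi> y)"
    using mean_value[of t 1] t by auto
  have "0 < \<phi> y"
    using concave_pos_up_to_zero[OF conc cont zero _ \<phi>u, of y] u v y by auto
  then have "0 < (1 - t) * (w y * \<phi> y)" using weight[of y] y t by simp
  then show False using y ft f1 by linarith
qed

section \<open>The mixture as a power series\<close>

text \<open>Extending the coefficients by \<open>0\<close> gives a power series over all of \<open>nat\<close>, to which
  termwise differentiation applies.\<close>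

definition mix_coeff :: "(nat \<Rightarrow> real) \<Rightarrow> nat \<Rightarrow> real" where
  "mix_coeff c p = (if p \<in> pspin_indices then c p else 0)"

lemma mix_coeff_nonneg: "even_mixture c \<Longrightarrow> 0 \<le> mix_coeff c p"
  by (auto simp: even_mixture_def mix_coeff_def)

lemma mix_coeff_sums_1:
  assumes "even_mixture c"
  shows "mix_coeff c sums 1"
proof -
  have "(c has_sum 1) pspin_indices" using assms by (simp add: even_mixture_def)
  also have "(c has_sum 1) pspin_indices \<longleftrightarrow> (mix_coeff c has_sum 1) UNIV"
    by (rule has_sum_cong_neutral) (auto simp: mix_coeff_def)
  finally show ?thesis by (rule has_sum_imp_sums)
qed

lemma summable_mix_coeff_2:
  assumes "even_mixture c"
  shows "summable (\<lambda>p. mix_coeff c p * 2 ^ p)"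
proof -
  have "(\<lambda>p. 2 ^ p * c p) summable_on pspin_indices" using assms by (simp add: even_mixture_def)
  also have "(\<lambda>p. 2 ^ p * c p) summable_on pspin_indices
      \<longleftrightarrow> (\<lambda>p. mix_coeff c p * 2 ^ p) summable_on UNIV"
    by (rule summable_on_cong_neutral) (auto simp: mix_coeff_def)
  finally show ?thesis by (rule summable_on_imp_summable)
qed

lemma xi_eq_suminf:
  assumes "even_mixture c" "\<bar>s\<bar> < 2"
  shows "xi c s = (\<Sum>p. mix_coeff c p * s ^ p)"
proof -
  have norm: "summable (\<lambda>p. norm (mix_coeff c p * s ^ p))"
    using powser_insidea[OF summable_mix_coeff_2[OF assms(1)], of s] assms(2) by simp
  have "((\<lambda>p. mix_coeff c p * s ^ p) has_sum (\<Sum>p. mix_coeff c p * s ^ p)) UNIV"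
    by (rule norm_summable_imp_has_sum[OF norm summable_sums[OF summable_norm_cancel[OF norm]]])
  then have "(\<Sum>\<^sub>\<infinity>p. mix_coeff c p * s ^ p) = (\<Sum>p. mix_coeff c p * s ^ p)"
    by (rule infsumI)
  moreover have "xi c s = (\<Sum>\<^sub>\<infinity>p. mix_coeff c p * s ^ p)"
    unfolding xi_def by (rule infsum_cong_neutral) (auto simp: mix_coeff_def)
  ultimately show ?thesis by simp
qed

lemma summable_diffs_mix_coeff:
  assumes "even_mixture c" "\<bar>s\<bar> < 2"
  shows "summable (\<lambda>n. diffs (mix_coeff c) n * s ^ n)"
  by (rule termdiff_converges[where K = 2])
     (use assms powser_inside[OF summable_mix_coeff_2] in auto)

lemma summable_diffs_diffs_mix_coeff:
  assumes "even_mixture c" "\<bar>s\<bar> < 2"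
  shows "summable (\<lambda>n. diffs (diffs (mix_coeff c)) n * s ^ n)"
  by (rule termdiff_converges[where K = 2])
     (use assms summable_diffs_mix_coeff in auto)

lemma xi_has_derivative_suminf:
  assumes "even_mixture c" "\<bar>s\<bar> < 2"
  shows "(xi c has_real_derivative (\<Sum>n. diffs (mix_coeff c) n * s ^ n)) (at s)"
proof (rule has_field_derivative_transform_within_open)
  show "((\<lambda>s. \<Sum>n. mix_coeff c n * s ^ n) has_real_derivative
      (\<Sum>n. diffs (mix_coeff c) n * s ^ n)) (at s)"
    by (rule termdiffs_strong[OF summable_mix_coeff_2]) (use assms in auto)
  show "open {-2<..<2::real}" by simp
qed (use assms xi_eq_suminf in auto)

lemma deriv_xi_eq_suminf:
  "even_mixture c \<Longrightarrow> \<bar>s\<bar> < 2 \<Longrightarrow> deriv (xi c) s = (\<Sum>n. diffs (mix_coeff c) n * s ^ n)"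
  by (rule DERIV_imp_deriv[OF xi_has_derivative_suminf])

lemma deriv_xi_has_derivative_suminf:
  assumes "even_mixture c" "\<bar>s\<bar> < 2"
  shows "(deriv (xi c) has_real_derivative (\<Sum>n. diffs (diffs (mix_coeff c)) n * s ^ n)) (at s)"
proof (rule has_field_derivative_transform_within_open)
  show "((\<lambda>s. \<Sum>n. diffs (mix_coeff c) n * s ^ n) has_real_derivative
      (\<Sum>n. diffs (diffs (mix_coeff c)) n * s ^ n)) (at s)"
    by (rule termdiffs_strong'[where K = 2]) (use assms summable_diffs_mix_coeff in auto)
  show "open {-2<..<2::real}" by simp
qed (use assms deriv_xi_eq_suminf in auto)

lemma deriv_deriv_xi_eq_suminf:
  "even_mixture c \<Longrightarrow> \<bar>s\<bar> < 2 \<Longrightarrow>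
    deriv (deriv (xi c)) s = (\<Sum>n. diffs (diffs (mix_coeff c)) n * s ^ n)"
  by (rule DERIV_imp_deriv[OF deriv_xi_has_derivative_suminf])

lemma xi_has_derivative:
  "even_mixture c \<Longrightarrow> \<bar>s\<bar> < 2 \<Longrightarrow> (xi c has_real_derivative deriv (xi c) s) (at s)"
  using xi_has_derivative_suminf deriv_xi_eq_suminf by simp

lemma deriv_xi_has_derivative:
  "even_mixture c \<Longrightarrow> \<bar>s\<bar> < 2 \<Longrightarrow>
    (deriv (xi c) has_real_derivative deriv (deriv (xi c)) s) (at s)"
  using deriv_xi_has_derivative_suminf deriv_deriv_xi_eq_suminf by simp

section \<open>Values and signs of the derivatives of the mixture\<close>

lemma xi_0: "even_mixture c \<Longrightarrow> xi c 0 = 0"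
  by (simp add: xi_eq_suminf powser_zero mix_coeff_def pspin_indices_def)

lemma xi_1: "even_mixture c \<Longrightarrow> xi c 1 = 1"
  using mix_coeff_sums_1[of c] by (simp add: xi_eq_suminf sums_iff)

lemma deriv_xi_0: "even_mixture c \<Longrightarrow> deriv (xi c) 0 = 0"
  by (simp add: deriv_xi_eq_suminf powser_zero diffs_def mix_coeff_def pspin_indices_def)

lemma deriv_deriv_xi_0: "even_mixture c \<Longrightarrow> deriv (deriv (xi c)) 0 = 2 * mix_coeff c 2"
  by (simp add: deriv_deriv_xi_eq_suminf powser_zero diffs_def numeral_2_eq_2[symmetric])

lemma diffs_mix_coeff_nonneg: "even_mixture c \<Longrightarrow> 0 \<le> diffs (mix_coeff c) n"
  by (simp add: diffs_def mix_coeff_nonneg)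

lemma ex_mix_coeff_pos:
  assumes "even_mixture c"
  obtains p where "0 < mix_coeff c (Suc (Suc p))"
proof -
  have "\<exists>q. mix_coeff c q \<noteq> 0"
  proof (rule ccontr)
    assume "\<nexists>q. mix_coeff c q \<noteq> 0"
    then have "mix_coeff c = (\<lambda>_. 0)" by auto
    then show False using mix_coeff_sums_1[OF assms] sums_unique2[OF sums_zero] by fastforce
  qed
  then obtain q where q: "mix_coeff c q \<noteq> 0" by blast
  then have "2 \<le> q" by (auto simp: mix_coeff_def pspin_indices_def split: if_splits)
  then have "Suc (Suc (q - 2)) = q" by simp
  then show thesis using that[of "q - 2"] q mix_coeff_nonneg[OF assms, of q] by simp
qed

lemma deriv_xi_pos:
  assumes c: "even_mixture c" and s: "0 < s" "s < 2"
  shows "0 < deriv (xi c) s"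
proof -
  obtain p where p: "0 < mix_coeff c (Suc (Suc p))" using ex_mix_coeff_pos[OF c] .
  have "0 < (\<Sum>n. diffs (mix_coeff c) n * s ^ n)"
  proof (rule suminf_pos2)
    show "summable (\<lambda>n. diffs (mix_coeff c) n * s ^ n)"
      using c s by (intro summable_diffs_mix_coeff) auto
    show "0 \<le> diffs (mix_coeff c) n * s ^ n" for n
      using s diffs_mix_coeff_nonneg[OF c, of n] by simp
    show "0 < diffs (mix_coeff c) (Suc p) * s ^ Suc p"
      using p s by (simp add: diffs_def)
  qed
  then show ?thesis using deriv_xi_eq_suminf[OF c] s by simp
qed

lemma deriv_deriv_xi_pos:
  assumes c: "even_mixture c" and s: "0 < s" "s < 2"
  shows "0 < deriv (deriv (xi c)) s"
proof -
  obtain p where p: "0 < mix_coeff c (Suc (Suc p))" using ex_mix_coeff_pos[OF c] .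
  have "0 < (\<Sum>n. diffs (diffs (mix_coeff c)) n * s ^ n)"
  proof (rule suminf_pos2)
    show "summable (\<lambda>n. diffs (diffs (mix_coeff c)) n * s ^ n)"
      using c s by (intro summable_diffs_diffs_mix_coeff) auto
    show "0 \<le> diffs (diffs (mix_coeff c)) n * s ^ n" for n
      using s mix_coeff_nonneg[OF c] by (simp add: diffs_def)
    show "0 < diffs (diffs (mix_coeff c)) p * s ^ p"
      using p s by (simp add: diffs_def)
  qed
  then show ?thesis using deriv_deriv_xi_eq_suminf[OF c] s by simp
qed

text \<open>In \<open>\<xi>'(1) = \<Sum> p c\<^sub>p\<close> the exponent \<open>2\<close> has weight \<open>2 c\<^sub>2 = \<xi>''(0)\<close>, and all others are at
  least \<open>4\<close>; so the sum is at least \<open>2 c\<^sub>2 + 4 (1 - c\<^sub>2) = 4 - 2 c\<^sub>2\<close>. The bound is used to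
  see that \<open>\<xi>'(1) = 2\<close> forces \<open>\<xi>''(0) \<ge> 2\<close>.\<close>

lemma deriv_xi_1_ge:
  assumes c: "even_mixture c"
  shows "4 - deriv (deriv (xi c)) 0 \<le> deriv (xi c) 1"
proof -
  let ?d = "mix_coeff c"
  have d0: "?d 0 = 0" by (simp add: mix_coeff_def pspin_indices_def)
  have "(\<lambda>n. ?d (Suc n)) sums 1"
    using mix_coeff_sums_1[OF c] d0 by (simp add: sums_Suc_iff)
  then have lower: "(\<lambda>n. 4 * ?d (Suc n) - (if n = 1 then 2 * ?d 2 else 0)) sums (4 * 1 - 2 * ?d 2)"
    by (intro sums_diff sums_mult sums_single[of 1 "\<lambda>_. 2 * ?d 2"])
  have upper: "diffs ?d sums deriv (xi c) 1"
    using summable_sums[OF summable_diffs_mix_coeff[OF c, of 1]] deriv_xi_eq_suminf[OF c, of 1]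
    by simp
  have le: "4 * ?d (Suc n) - (if n = 1 then 2 * ?d 2 else 0) \<le> diffs ?d n" for n
  proof (cases "n = 1 \<or> ?d (Suc n) = 0")
    case True
    then show ?thesis
      using mix_coeff_nonneg[OF c, of 2] by (auto simp: diffs_def numeral_2_eq_2[symmetric])
  next
    case False
    then have "even (Suc n)" "2 \<le> Suc n" "n \<noteq> 1"
      by (auto simp: mix_coeff_def pspin_indices_def split: if_splits)
    then have "4 \<le> Suc n" by presburger
    then have "4 * ?d (Suc n) \<le> real (Suc n) * ?d (Suc n)"
      by (intro mult_right_mono mix_coeff_nonneg[OF c]) linarith
    then show ?thesis using False by (simp add: diffs_def)
  qed
  have "4 * 1 - 2 * ?d 2 \<le> deriv (xi c) 1" by (rule sums_le[OF le lower upper])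
  then show ?thesis using deriv_deriv_xi_0[OF c] by simp
qed

section \<open>Boundary values of zeta and the sign of its derivative\<close>

text \<open>For \<open>z = 0\<close> the defining equation reads \<open>\<xi>'(1) = 2\<close>; then \<open>\<xi>''(0) \<ge> 2 = \<xi>'(1)\<close>, against
  the strict inequality.\<close>

lemma z_param_pos:
  assumes "even_mixture c" "is_z_param c z"
    and "deriv (deriv (xi c)) 0 * (1 + z) < deriv (xi c) 1"
  shows "0 < z"
proof (rule ccontr)
  assume "\<not> 0 < z"
  then have z: "z = 0" using assms(2) by (simp add: is_z_param_def)
  then have "1 / deriv (xi c) 1 = 1 / 2"
    using assms(2) by (simp add: is_z_param_def z_rhs_def)
  then have "deriv (xi c) 1 = 2" by (simp add: field_simps)
  then show False using deriv_xi_1_ge[OF assms(1)] assms(3) z by simp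
qed

lemma zeta_fun_0: "even_mixture c \<Longrightarrow> zeta_fun c z 0 = 0"
  by (simp add: zeta_fun_def xi_0 deriv_xi_0)

text \<open>Multiplied by \<open>\<xi>'(1)\<close>, the equation for \<open>z\<close> is the vanishing of \<open>\<zeta>\<close> at \<open>1\<close>.\<close>

lemma zeta_fun_1:
  assumes c: "even_mixture c" and "is_z_param c z" and z: "0 < z"
  shows "zeta_fun c z 1 = 0"
proof -
  let ?a = "deriv (xi c) 1"
  have a: "0 < ?a" using deriv_xi_pos[OF c] by simp
  have "1 / ?a = (1 + z) / z\<^sup>2 * ln (1 + z) - 1 / z"
    using assms by (simp add: is_z_param_def z_rhs_def)
  then have "?a * (1 / ?a) = ?a * ((1 + z) / z\<^sup>2 * ln (1 + z) - 1 / z)" by simp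
  then have "1 = (1 + z) * ?a / z\<^sup>2 * ln (1 + z) - ?a / z"
    using a by (simp add: algebra_simps)
  then show ?thesis using a by (simp add: zeta_fun_def xi_1[OF c])
qed

definition zeta_sign :: "(nat \<Rightarrow> real) \<Rightarrow> real \<Rightarrow> real \<Rightarrow> real" where
  "zeta_sign c z s = (1 + z - z * s) - deriv (xi c) 1 * (s / deriv (xi c) s)"

text \<open>Here \<open>D\<close> stands for \<open>a + z \<xi>'(s)\<close>. Taking it as the independent variable, in place of
  \<open>a = D - z x\<close>, makes both sides polynomial after multiplying by powers of \<open>z\<close> and \<open>D\<close>.\<close>

lemma zeta_derivative_algebra:
  fixes x y z s D :: real
  assumes "z \<noteq> 0" "D \<noteq> 0"
  shows "x + (y * (1 - s) - x) + y / z - (1 + z) * (D - z * x) / z\<^sup>2 * (z * y / D)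
    = y * ((1 + z) * x / D - s)"
  using assms by (simp add: divide_simps) (simp add: algebra_simps power2_eq_square)

text \<open>This form of the derivative, without division by \<open>\<xi>'(s)\<close>, is valid at \<open>0\<close> too and so gives
  the continuity of \<open>\<zeta>\<close> on all of \<open>[0, 1]\<close>.\<close>

lemma zeta_fun_has_derivative:
  assumes c: "even_mixture c" and z: "0 < z" and s: "0 \<le> s" "s < 2"
  shows "(zeta_fun c z has_real_derivative
    deriv (deriv (xi c)) s *
      ((1 + z) * deriv (xi c) s / (deriv (xi c) 1 + z * deriv (xi c) s) - s)) (at s)"
proof -
  let ?a = "deriv (xi c) 1" and ?x = "deriv (xi c) s" and ?y = "deriv (deriv (xi c)) s"
  have a: "0 < ?a" using deriv_xi_pos[OF c] by simp
  have x: "0 \<le> ?x" using deriv_xi_pos[OF c, of s] deriv_xi_0[OF c] s by (cases "s = 0") auto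
  have ax: "0 < ?a + z * ?x" using a x z by (simp add: add_pos_nonneg)
  have arg: "0 < 1 + z * ?x / ?a" using a x z by (simp add: add_pos_nonneg)
  have X: "(xi c has_real_derivative ?x) (at s)" "(deriv (xi c) has_real_derivative ?y) (at s)"
    using xi_has_derivative[OF c] deriv_xi_has_derivative[OF c] s by auto
  have "((\<lambda>s. xi c s + deriv (xi c) s * (1 - s)) has_real_derivative
      ?x + (?y * (1 - s) - ?x)) (at s)"
    by (auto intro!: derivative_eq_intros X)
  moreover have "((\<lambda>s. ln (1 + z * deriv (xi c) s / ?a)) has_real_derivative
      z * ?y / ?a / (1 + z * ?x / ?a)) (at s)"
    using arg a by (auto intro!: derivative_eq_intros X simp: mult_ac)
  ultimately have "(zeta_fun c z has_real_derivative
      ?x + (?y * (1 - s) - ?x) + ?y / z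
        - (1 + z) * ?a / z\<^sup>2 * (z * ?y / ?a / (1 + z * ?x / ?a))) (at s)"
    unfolding zeta_fun_def[abs_def]
    by (intro DERIV_diff DERIV_add[OF _ DERIV_cdivide[OF X(2)]] DERIV_cmult)
  moreover have log_term: "z * ?y / ?a / (1 + z * ?x / ?a) = z * ?y / (?a + z * ?x)"
    using a ax arg by (simp add: divide_simps)
  moreover have total: "?x + (?y * (1 - s) - ?x) + ?y / z - (1 + z) * ?a / z\<^sup>2 * (z * ?y / (?a + z * ?x))
      = ?y * ((1 + z) * ?x / (?a + z * ?x) - s)"
    using zeta_derivative_algebra[of z "?a + z * ?x" ?x ?y s] z ax by simp
  ultimately show ?thesis by (simp only: log_term total)
qed

lemma zeta_derivative_sign_algebra:
  fixes x y z s a :: real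
  assumes "x \<noteq> 0" "a + z * x \<noteq> 0"
  shows "y * ((1 + z) * x / (a + z * x) - s)
    = y * x / (a + z * x) * ((1 + z - z * s) - a * (s / x))"
proof -
  have "(1 + z) * x / (a + z * x) - s = ((1 + z) * x - s * (a + z * x)) / (a + z * x)"
    using assms(2) by (simp add: diff_divide_distrib)
  also have "(1 + z) * x - s * (a + z * x) = x * ((1 + z - z * s) - a * (s / x))"
    using assms(1) by (simp add: algebra_simps)
  finally show ?thesis by simp
qed

lemma zeta_fun_has_derivative_sign:
  assumes c: "even_mixture c" and z: "0 < z" and s: "0 < s" "s < 2"
  shows "(zeta_fun c z has_real_derivative
    deriv (deriv (xi c)) s * deriv (xi c) s / (deriv (xi c) 1 + z * deriv (xi c) s)
      * zeta_sign c z s) (at s)"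
proof -
  have a: "0 < deriv (xi c) 1" and x: "0 < deriv (xi c) s" using deriv_xi_pos[OF c] s by auto
  then have "0 < deriv (xi c) 1 + z * deriv (xi c) s" using z by (simp add: add_pos_pos)
  then have "deriv (deriv (xi c)) s *
      ((1 + z) * deriv (xi c) s / (deriv (xi c) 1 + z * deriv (xi c) s) - s) =
    deriv (deriv (xi c)) s * deriv (xi c) s / (deriv (xi c) 1 + z * deriv (xi c) s)
      * zeta_sign c z s"
    using zeta_derivative_sign_algebra[of "deriv (xi c) s" "deriv (xi c) 1" z] x
    by (simp add: zeta_sign_def)
  then show ?thesis using zeta_fun_has_derivative[OF c z, of s] s by simp
qed

text \<open>The quotient \<open>s / \<xi>'(s)\<close> has the form \<open>0 / 0\<close> at \<open>0\<close>. Clearing the denominator gives a function that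
  vanishes at \<open>0\<close> with derivative \<open>(1 + z) \<xi>''(0) - \<xi>'(1) < 0\<close>.\<close>

lemma zeta_sign_neg_near_0:
  assumes c: "even_mixture c"
    and gap: "deriv (deriv (xi c)) 0 * (1 + z) < deriv (xi c) 1"
  shows "eventually (\<lambda>s. zeta_sign c z s < 0) (at_right 0)"
proof -
  define g where "g s = (1 + z - z * s) * deriv (xi c) s - deriv (xi c) 1 * s" for s
  have slope: "(g has_real_derivative (1 + z) * deriv (deriv (xi c)) 0 - deriv (xi c) 1) (at 0)"
    unfolding g_def
    by (auto intro!: derivative_eq_intros deriv_xi_has_derivative[OF c] simp: deriv_xi_0[OF c])
  have "(1 + z) * deriv (deriv (xi c)) 0 - deriv (xi c) 1 < 0"
    using gap by (simp add: mult.commute)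
  then obtain \<delta> where \<delta>: "0 < \<delta>" "\<And>h. 0 < h \<Longrightarrow> h < \<delta> \<Longrightarrow> g (0 + h) < g 0"
    using DERIV_neg_dec_right[OF slope] by blast
  have g0: "g 0 = 0" by (simp add: g_def deriv_xi_0[OF c])
  have "zeta_sign c z s < 0" if s: "0 < s" "s < min \<delta> 2" for s
  proof -
    have x: "0 < deriv (xi c) s" using deriv_xi_pos[OF c] s by simp
    then have "zeta_sign c z s = g s / deriv (xi c) s"
      by (simp add: zeta_sign_def g_def field_simps)
    then show ?thesis using \<delta>(2)[of s] g0 s x by (simp add: divide_neg_pos)
  qed
  then show ?thesis
    using \<delta>(1) by (auto simp: eventually_at_right_field intro!: exI[of _ "min \<delta> 2"])
qed

theorem theorem7:
  fixes c :: "nat \<Rightarrow> real" and z h :: real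
  assumes "even_mixture c"
    and "is_z_param c z"
    and "h = 0"
    and "deriv (xi c) 1 > deriv (deriv (xi c)) 0 * (1 + z)"
    and "convex_on {0<..<1} (\<lambda>s. s / deriv (xi c) s)"
  shows "\<forall>s\<in>{0<..<1}. zeta_fun c z s < 0"
proof
  note c = assms(1)
  have z: "0 < z" by (rule z_param_pos[OF assms(1,2,4)])
  have a: "0 < deriv (xi c) 1" using deriv_xi_pos[OF c] by simp
  fix t :: real
  assume t: "t \<in> {0<..<1}"
  let ?w = "\<lambda>s. deriv (deriv (xi c)) s * deriv (xi c) s / (deriv (xi c) 1 + z * deriv (xi c) s)"
  show "zeta_fun c z t < 0"
  proof (rule neg_between_zeros_if_concave_sign[where f = "zeta_fun c z" and \<phi> = "zeta_sign c z" and t = t and w = ?w])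
    show "continuous_on {0..1} (zeta_fun c z)"
      by (intro continuous_at_imp_continuous_on ballI
          DERIV_isCont[OF zeta_fun_has_derivative[OF c z]]) auto
    show "zeta_fun c z 0 = 0" by (rule zeta_fun_0[OF c])
    show "zeta_fun c z 1 = 0" by (rule zeta_fun_1[OF c assms(2) z])
    show "(zeta_fun c z has_real_derivative ?w s * zeta_sign c z s) (at s)" if "0 < s" "s < 1" for s
      using zeta_fun_has_derivative_sign[OF c z] that by simp
    show "0 < ?w s" if "0 < s" "s < 1" for s
      using that a z deriv_xi_pos[OF c, of s] deriv_deriv_xi_pos[OF c, of s]
      by (simp add: add_pos_pos)
    have "concave_on {0<..<1} (\<lambda>s. 1 + z - z * s)"
      by (auto simp: concave_on_iff algebra_simps simp flip: distrib_right)
    moreover have "convex_on {0<..<1} (\<lambda>s. deriv (xi c) 1 * (s / deriv (xi c) s))"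
      by (rule convex_on_cmul) (use a assms(5) in auto)
    ultimately show "concave_on {0<..<1} (zeta_sign c z)"
      unfolding zeta_sign_def[abs_def] by (rule concave_on_diff)
    have "continuous_on {0<..1} (deriv (xi c))"
      by (intro continuous_at_imp_continuous_on ballI DERIV_isCont[OF deriv_xi_has_derivative[OF c]])
         auto
    then show "continuous_on {0<..1} (zeta_sign c z)"
      unfolding zeta_sign_def[abs_def] using deriv_xi_pos[OF c]
      by (intro continuous_intros) force+
    show "zeta_sign c z 1 = 0" using a by (simp add: zeta_sign_def)
    show "eventually (\<lambda>s. zeta_sign c z s < 0) (at_right 0)"
      by (rule zeta_sign_neg_near_0[OF c assms(4)])
  qed (use t in auto)
qed

end
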